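(* Let $\mathbb K$ be a field of characteristic $0$, let $n\geq 2$, and let $\Gamma\subset\mathbb P^n_{\mathbb K}$ be a reduced finite set of ($\mathbb K$-rational) points, not all contained in a hyperplane. Let $d(\Gamma)$ be the minimum distance of $\Gamma$ and let $A_n$ be the minimum socle degree of $R/I$, where $R=\mathbb K[x_0,\ldots,x_n]$ and $I\subset R$ is the ideal of $\Gamma$. Then $$d(\Gamma)\geq A_n.$$
   Context: Let $\mathrm{hyp}(\Gamma)$ be the maximum number of points of $\Gamma$ contained in any hyperplane of $\mathbb P^n_{\mathbb K}$. The minimum distance of $\Gamma$ is $d(\Gamma)=|\Gamma|-\mathrm{hyp}(\Gamma)$. $R=\mathbb K[x_0,\ldots,x_n]$ has the standard grading and $I\subset R$ is the homogeneous ideal of all polynomials vanishing on $\Gamma$. The graded minimal free resolution of $R/I$ has length $n$: $$0\rightarrow F_n=\bigoplus_i R(-a_i)\rightarrow\cdots\rightarrow F_1\rightarrow R\rightarrow R/I\rightarrow 0.$$ The minimum socle degree of $R/I$ is $A_n=\min_i\{a_i-n\}$, where the $a_i$ are the shifts in the last module $F_n$. *)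

theory Defs
  imports
    "HOL-Analysis.Cartesian_Space"
    "HOL-Library.Poly_Mapping"
    "Jordan_Normal_Form.Matrix_Kernel"
begin

text \<open>Throughout, the coordinates are indexed by a finite type \<open>'v\<close> with \<open>CARD('v) = n + 1\<close>.
  A point of projective \<open>n\<close>-space is a line through the origin of \<open>'k ^ 'v\<close>, a hyperplane is
  a linear subspace of dimension \<open>n\<close>, and incidence is inclusion.\<close>

definition proj_points :: "('k::field ^ 'v::finite) set set" where
  "proj_points = {P. vec.subspace P \<and> vec.dim P = 1}"

definition proj_hyperplanes :: "('k::field ^ 'v::finite) set set" where
  "proj_hyperplanes = {H. vec.subspace H \<and> vec.dim H = CARD('v) - 1}"

definition hyp :: "('k::field ^ 'v::finite) set set \<Rightarrow> nat" where
  "hyp \<Gamma> = Max ((\<lambda>H. card {P \<in> \<Gamma>. P \<subseteq> H}) ` proj_hyperplanes)"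

definition min_distance :: "('k::field ^ 'v::finite) set set \<Rightarrow> nat" where
  "min_distance \<Gamma> = card \<Gamma> - hyp \<Gamma>"

text \<open>The polynomial ring \<open>R\<close>: finitely supported maps from exponent vectors to coefficients,
  with the convolution product of \<^theory>\<open>HOL-Library.Poly_Mapping\<close>.\<close>

type_synonym ('v, 'k) polyring = "('v \<Rightarrow>\<^sub>0 nat) \<Rightarrow>\<^sub>0 'k"

definition eval_at :: "'k::field ^ 'v::finite \<Rightarrow> ('v, 'k) polyring \<Rightarrow> 'k" where
  "eval_at x p =
    (\<Sum>m \<in> Poly_Mapping.keys p.
       Poly_Mapping.lookup p m * (\<Prod>i\<in>UNIV. Finite_Cartesian_Product.vec_nth x i ^ Poly_Mapping.lookup m i))"

definition monomial_degree :: "('v::finite \<Rightarrow>\<^sub>0 nat) \<Rightarrow> nat" where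
  "monomial_degree m = (\<Sum>i\<in>UNIV. Poly_Mapping.lookup m i)"

text \<open>The zero polynomial is homogeneous of every degree, and it is the only one that is
  homogeneous of a negative degree.\<close>

definition homogeneous :: "int \<Rightarrow> ('v::finite, 'k::zero) polyring \<Rightarrow> bool" where
  "homogeneous d p \<longleftrightarrow> (\<forall>m \<in> Poly_Mapping.keys p. int (monomial_degree m) = d)"

text \<open>A polynomial vanishes at a projective point if it vanishes at all of its homogeneous
  coordinate vectors; over an infinite field this holds iff all of its homogeneous
  components do so.\<close>

definition vanishing_ideal :: "('k::field ^ 'v::finite) set set \<Rightarrow> ('v, 'k) polyring set" where
  "vanishing_ideal \<Gamma> = {p. \<forall>P\<in>\<Gamma>. \<forall>x\<in>P. eval_at x p = 0}"

text \<open>A list \<open>[a\<^sub>0, \<dots>, a\<^sub>r\<^sub>-\<^sub>1]\<close> of integers stands for the graded free module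
  \<open>R(-a\<^sub>0) \<oplus> \<dots> \<oplus> R(-a\<^sub>r\<^sub>-\<^sub>1)\<close>, whose elements are the column vectors of length \<open>r\<close> over \<open>R\<close>.
  A graded map of degree \<open>0\<close> from the module of \<open>b\<close> to that of \<open>c\<close> is a matrix whose entry
  \<open>(i, j)\<close> is homogeneous of degree \<open>b\<^sub>j - c\<^sub>i\<close>.\<close>

definition graded_map ::
    "int list \<Rightarrow> int list \<Rightarrow> ('v::finite, 'k::field) polyring mat \<Rightarrow> bool" where
  "graded_map b c M \<longleftrightarrow>
     M \<in> carrier_mat (length c) (length b) \<and>
     (\<forall>i<length c. \<forall>j<length b. homogeneous (b ! j - c ! i) (M $$ (i, j)))"

definition mat_image :: "'a::semiring_0 mat \<Rightarrow> 'a Matrix.vec set" where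
  "mat_image M = {M *\<^sub>v v | v. v \<in> carrier_vec (dim_col M)}"

text \<open>\<open>0 \<rightarrow> F\<^sub>N \<rightarrow> \<dots> \<rightarrow> F\<^sub>1 \<rightarrow> F\<^sub>0 = R \<rightarrow> R/I \<rightarrow> 0\<close> is exact, where \<open>a k\<close> lists the shifts of \<open>F\<^sub>k\<close>
  and \<open>D k\<close> is the matrix of \<open>F\<^sub>k \<rightarrow> F\<^sub>k\<^sub>-\<^sub>1\<close>. Exactness at \<open>R\<close> says that the image of \<open>D 1\<close> is \<open>I\<close>.
  The last module \<open>F\<^sub>N\<close> is not required to be nonzero.\<close>

definition graded_free_resolution ::
    "nat \<Rightarrow> ('v::finite, 'k::field) polyring set \<Rightarrow>
     (nat \<Rightarrow> int list) \<Rightarrow> (nat \<Rightarrow> ('v, 'k) polyring mat) \<Rightarrow> bool" where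
  "graded_free_resolution N I a D \<longleftrightarrow>
     a 0 = [0] \<and>
     (\<forall>k\<in>{1..N}. graded_map (a k) (a (k - 1)) (D k)) \<and>
     mat_image (D 1) = {v \<in> carrier_vec 1. vec_index v 0 \<in> I} \<and>
     (\<forall>k\<in>{1..<N}. mat_kernel (D k) = mat_image (D (k + 1))) \<and>
     mat_kernel (D N) = {0\<^sub>v (length (a N))}"

text \<open>Minimality: the image of \<open>F\<^sub>k\<close> lies in \<open>\<mm> F\<^sub>k\<^sub>-\<^sub>1\<close>, where \<open>\<mm>\<close> is the ideal generated by the
  variables, i.e. the matrix entries have no constant term.\<close>

definition minimal_graded_free_resolution ::
    "nat \<Rightarrow> ('v::finite, 'k::field) polyring set \<Rightarrow>
     (nat \<Rightarrow> int list) \<Rightarrow> (nat \<Rightarrow> ('v, 'k) polyring mat) \<Rightarrow> bool" where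
  "minimal_graded_free_resolution N I a D \<longleftrightarrow>
     graded_free_resolution N I a D \<and>
     (\<forall>k\<in>{1..N}. \<forall>i<length (a (k - 1)). \<forall>j<length (a k).
        Poly_Mapping.lookup (D k $$ (i, j)) 0 = 0)"

definition min_socle_degree :: "nat \<Rightarrow> (nat \<Rightarrow> int list) \<Rightarrow> int" where
  "min_socle_degree n a = Min ((\<lambda>b. b - int n) ` set (a n))"

end

theory Submission
  imports Defs "HOL-Library.Function_Algebras"
begin

text \<open>Choose a hyperplane containing \<open>hyp \<Gamma>\<close> of the points and a further point \<open>P \<in> \<Gamma>\<close>. The product \<open>f\<close>
  of \<open>d(\<Gamma>)\<close> linear forms, one for the hyperplane and one for each point off it other than \<open>P\<close>,
  vanishes on all of \<open>\<Gamma>\<close> except at \<open>P\<close>. If \<open>L\<^sub>0, \<dots>, L\<^sub>n\<^sub>-\<^sub>1\<close> are the linear equations of \<open>P\<close>,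
  then \<open>L\<^sub>j f \<in> I\<close> for all \<open>j\<close> although \<open>f \<notin> I\<close>. As the \<open>L\<^sub>j\<close> form a regular sequence, computing
  \<open>Tor\<^sub>n(R/I, R/(L\<^sub>0, \<dots>, L\<^sub>n\<^sub>-\<^sub>1))\<close> from the Koszul complex and from the given resolution turns \<open>f\<close> into a
  nonzero element of \<open>F\<^sub>n\<close> of degree \<open>d(\<Gamma>) + n\<close>, which forces a shift \<open>\<le> d(\<Gamma>) + n\<close> in \<open>F\<^sub>n\<close>. The
  comparison is an explicit diagram chase that uses one \<open>L\<^sub>j\<close> per step of the resolution.\<close>

section \<open>Regular sequences and exact complexes\<close>

locale module_with_sequence = Modules.module scale
  for scale :: "'r::comm_ring_1 \<Rightarrow> 'm::ab_group_add \<Rightarrow> 'm" +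
  fixes L :: "nat \<Rightarrow> 'r"
begin

text \<open>For a submodule \<open>M\<close> this is the product of \<open>M\<close> with the ideal
  of \<open>L 0\<close>, ..., \<open>L (j - 1)\<close>. Splitting off the last generator matches the
  shape of the regularity condition.\<close>

primrec ideal_mult :: "nat \<Rightarrow> 'm set \<Rightarrow> 'm set" where
  "ideal_mult 0 M = {0}"
| "ideal_mult (Suc j) M = {scale (L j) u + w | u w. u \<in> M \<and> w \<in> ideal_mult j M}"

lemma ideal_mult_SucI: "u \<in> M \<Longrightarrow> w \<in> ideal_mult j M \<Longrightarrow> scale (L j) u + w \<in> ideal_mult (Suc j) M"
  by auto

lemma subspace_ideal_mult:
  assumes "subspace M"
  shows "subspace (ideal_mult j M)"
proof (induction j)
  case 0
  then show ?case by (simp add: subspace_def)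
next
  case (Suc j)
  show ?case
  proof (rule subspaceI)
    show "0 \<in> ideal_mult (Suc j) M"
      using ideal_mult_SucI[OF subspace_0[OF assms] subspace_0[OF Suc.IH]] by simp
  next
    fix x y assume "x \<in> ideal_mult (Suc j) M" "y \<in> ideal_mult (Suc j) M"
    then obtain u w u' w' where
      "x = scale (L j) u + w" "u \<in> M" "w \<in> ideal_mult j M"
      "y = scale (L j) u' + w'" "u' \<in> M" "w' \<in> ideal_mult j M" by auto
    moreover from this have "x + y = scale (L j) (u + u') + (w + w')"
      by (simp add: scale_right_distrib)
    ultimately show "x + y \<in> ideal_mult (Suc j) M"
      using ideal_mult_SucI subspace_add[OF assms] subspace_add[OF Suc.IH] by metis
  next
    fix c x assume "x \<in> ideal_mult (Suc j) M"
    then obtain u w where "x = scale (L j) u + w" "u \<in> M" "w \<in> ideal_mult j M" by auto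
    moreover from this have "scale c x = scale (L j) (scale c u) + scale c w"
      by (simp add: scale_right_distrib mult.commute)
    ultimately show "scale c x \<in> ideal_mult (Suc j) M"
      using ideal_mult_SucI subspace_scale[OF assms] subspace_scale[OF Suc.IH] by metis
  qed
qed

lemma ideal_mult_mono: "M \<subseteq> N \<Longrightarrow> ideal_mult j M \<subseteq> ideal_mult j N"
proof (induction j)
  case (Suc j)
  then show ?case unfolding ideal_mult.simps by blast
qed simp

lemma ideal_mult_subset:
  assumes "subspace M"
  shows "ideal_mult j M \<subseteq> M"
proof (induction j)
  case 0
  then show ?case using subspace_0[OF assms] by simp
next
  case (Suc j)
  then show ?case using subspace_add[OF assms] subspace_scale[OF assms] by auto
qed

lemma ideal_mult_image:
  assumes "Modules.module_hom scale scale h"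
  shows "ideal_mult j (h ` M) = h ` ideal_mult j M"
proof (induction j)
  case 0
  then show ?case using Modules.module_hom.zero[OF assms] by simp
next
  case (Suc j)
  have "ideal_mult (Suc j) (h ` M) =
      {scale (L j) (h u) + h w | u w. u \<in> M \<and> w \<in> ideal_mult j M}"
    by (simp add: Suc.IH) blast
  also have "\<dots> = {h (scale (L j) u + w) | u w. u \<in> M \<and> w \<in> ideal_mult j M}"
    by (simp add: Modules.module_hom.add[OF assms] Modules.module_hom.scale[OF assms])
  also have "\<dots> = h ` ideal_mult (Suc j) M" by auto
  finally show ?case .
qed

end

text \<open>\<open>\<pi> k \<delta>\<close> is the projection of the module \<open>F k\<close> onto its component of degree \<open>\<delta>\<close>. The complex is
  extended by \<open>F (n + 1) = 0\<close>, so that exactness at \<open>F n\<close> is injectivity of \<open>d n\<close>.\<close>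

locale graded_exact_complex = module_with_sequence scale L
  for scale :: "'r::comm_ring_1 \<Rightarrow> 'm::ab_group_add \<Rightarrow> 'm" and L :: "nat \<Rightarrow> 'r" +
  fixes n :: nat and F :: "nat \<Rightarrow> 'm set" and d :: "nat \<Rightarrow> 'm \<Rightarrow> 'm"
    and \<pi> :: "nat \<Rightarrow> int \<Rightarrow> 'm \<Rightarrow> 'm"
  assumes subspace_F: "subspace (F k)"
    and F_top: "F (Suc n) = {0}"
    and hom_d: "Modules.module_hom scale scale (d k)"
    and d_in: "d (Suc k) ` F (Suc k) \<subseteq> F k"
    and exact: "Suc k \<le> n \<Longrightarrow> {v \<in> F (Suc k). d (Suc k) v = 0} = d (Suc (Suc k)) ` F (Suc (Suc k))"
    and regular: "j < n \<Longrightarrow> v \<in> F k \<Longrightarrow> scale (L j) v \<in> ideal_mult j (F k) \<Longrightarrow> v \<in> ideal_mult j (F k)"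
    and \<pi>_add: "\<pi> k \<delta> (u + v) = \<pi> k \<delta> u + \<pi> k \<delta> v"
    and \<pi>_idem: "\<pi> k \<delta> (\<pi> k \<delta> v) = \<pi> k \<delta> v"
    and \<pi>_in: "\<pi> k \<delta> v \<in> F k"
    and \<pi>_d: "\<pi> k \<delta> (d (Suc k) v) = d (Suc k) (\<pi> (Suc k) \<delta> v)"
    and \<pi>_L: "j < n \<Longrightarrow> \<pi> k (\<delta> + 1) (scale (L j) v) = scale (L j) (\<pi> k \<delta> v)"
begin

abbreviation J :: "nat \<Rightarrow> 'm set \<Rightarrow> 'm set" where
  "J \<equiv> ideal_mult"

text \<open>Boundaries rather than cycles: \<open>Z 0\<close> then plays the role of the ideal, and
  for 1 \<le> k \<le> n exactness identifies \<open>Z k\<close> with the cycles.\<close>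

definition Z :: "nat \<Rightarrow> 'm set" where
  "Z k = d (Suc k) ` F (Suc k)"

lemma subspace_Z: "subspace (Z k)"
  unfolding Z_def by (rule Modules.module_hom.subspace_image[OF hom_d subspace_F])

lemma Z_subset: "Z k \<subseteq> F k"
  unfolding Z_def by (rule d_in)

lemma Z_Suc: "Suc k \<le> n \<Longrightarrow> v \<in> Z (Suc k) \<longleftrightarrow> v \<in> F (Suc k) \<and> d (Suc k) v = 0"
  using exact[of k] unfolding Z_def by blast

lemma \<pi>_zero: "\<pi> k \<delta> 0 = 0"
  using \<pi>_add[of k \<delta> 0 0] by simp

text \<open>The generators \<open>L i\<close> have degree 1, so the submodule is graded.\<close>

lemma \<pi>_ideal_mult: "j \<le> n \<Longrightarrow> v \<in> J j (F k) \<Longrightarrow> \<pi> k \<delta> v \<in> J j (F k)"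
proof (induction j arbitrary: v)
  case 0
  then show ?case by (simp add: \<pi>_zero)
next
  case (Suc j)
  then obtain u w where "v = scale (L j) u + w" "u \<in> F k" "w \<in> J j (F k)" by auto
  moreover from this have "\<pi> k \<delta> v = scale (L j) (\<pi> k (\<delta> - 1) u) + \<pi> k \<delta> w"
    using \<pi>_add \<pi>_L[of j k "\<delta> - 1"] Suc.prems by simp
  ultimately show ?case
    using Suc \<pi>_in by simp (metis Suc_leD)
qed

text \<open>Since \<open>F k / Z k\<close> is a \<open>k\<close>-th syzygy module, \<open>Tor\<^sub>1(R/J\<^sub>j, F k / Z k)\<close> vanishes for \<open>j \<le> k\<close>.\<close>

lemma ideal_mult_Int_Z: "j \<le> k \<Longrightarrow> k \<le> n \<Longrightarrow> y \<in> J j (F k) \<Longrightarrow> y \<in> Z k \<Longrightarrow> y \<in> J j (Z k)"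
proof (induction j arbitrary: k y)
  case 0
  then show ?case by simp
next
  case (Suc j)
  then obtain m where k: "k = Suc m" by (cases k) auto
  have m: "j \<le> m" "m \<le> n" "Suc m \<le> n" using Suc.prems k by auto
  interpret d: Modules.module_hom scale scale "d k" by (rule hom_d)
  note JF = subspace_ideal_mult[OF subspace_F]
  obtain u y' where y: "y = scale (L j) u + y'" and u: "u \<in> F k" and y': "y' \<in> J j (F k)"
    using Suc.prems by auto
  \<comment> \<open>Applying the differential to the cycle \<open>y\<close> expresses
    \<open>L j\<close> times \<open>d k u\<close> through the earlier \<open>L i\<close>. Regularity
    on \<open>F m\<close> and the induction hypothesis one module lower then put
    \<open>d k u\<close> into \<open>J j (Z m)\<close>.\<close>
  have "d k y = 0" using Suc.prems Z_Suc m k by blast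
  then have eq: "scale (L j) (d k u) = - d k y'"
    unfolding y d.add d.scale by (simp add: eq_neg_iff_add_eq_0)
  have "d k ` J j (F k) \<subseteq> J j (F m)"
    using ideal_mult_mono[OF d_in[of m]] k ideal_mult_image[OF hom_d] by metis
  then have "- d k y' \<in> J j (F m)"
    using y' subspace_neg[OF JF] by blast
  moreover have "d k u \<in> F m" using u d_in[of m] k by blast
  ultimately have "d k u \<in> J j (F m)"
    using regular[of j "d k u" m] eq Suc.prems by simp
  moreover have "d k u \<in> Z m" using u k unfolding Z_def by blast
  ultimately have "d k u \<in> J j (Z m)" using Suc.IH m by blast
  then obtain t where t: "t \<in> J j (F k)" "d k u = d k t"
    unfolding Z_def k ideal_mult_image[OF hom_d] by blast
  \<comment> \<open>As \<open>t\<close> has the same boundary as \<open>u\<close>, the coefficient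
    \<open>u\<close> can be traded for the cycle \<open>w\<close>; the error stays in
    \<open>J j (F k)\<close>.\<close>
  define w where "w = u - t"
  have tF: "t \<in> F k" using t ideal_mult_subset[OF subspace_F] by blast
  have w: "w \<in> Z k"
    using d.diff[of u t] t subspace_diff[OF subspace_F u tF] Z_Suc[OF m(3), of w] k
    unfolding w_def by simp
  have y2: "y = scale (L j) w + (scale (L j) t + y')"
    unfolding y w_def by (simp add: scale_right_diff_distrib)
  have in1: "scale (L j) t + y' \<in> J j (F k)"
    using t y' subspace_add[OF JF] subspace_scale[OF JF] by blast
  have "scale (L j) t + y' = y - scale (L j) w" using y2 by (simp add: algebra_simps)
  then have "scale (L j) t + y' \<in> Z k"
    using Suc.prems w subspace_diff[OF subspace_Z] subspace_scale[OF subspace_Z] by metis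
  \<comment> \<open>Second use of the induction hypothesis, now in the same module with fewer
    \<open>L i\<close>.\<close>
  then have "scale (L j) t + y' \<in> J j (Z k)"
    using Suc.IH[OF _ _ in1] Suc.prems by simp
  then show ?case unfolding y2 using w by auto
qed

text \<open>Modulo \<open>Z k + J k (F k)\<close>, such a \<open>g\<close> represents a nonzero element of
  \<open>Tor\<^sub>k(R/I, R/J\<^sub>k)\<close> of degree \<open>\<delta>\<close> that is killed by the remaining \<open>L i\<close>.\<close>

definition socle_element :: "nat \<Rightarrow> int \<Rightarrow> 'm \<Rightarrow> bool" where
  "socle_element k \<delta> g \<longleftrightarrow> g \<in> F k \<and> \<pi> k \<delta> g = g \<and>
     (\<forall>w\<in>Z k. g - w \<notin> J k (F k)) \<and>
     (\<forall>i. k \<le> i \<and> i < n \<longrightarrow> (\<exists>w\<in>Z k. scale (L i) g - w \<in> J k (F k)))"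

text \<open>A connecting homomorphism made explicit: \<open>L k\<close> kills the class of
  \<open>g\<close>, so \<open>L k\<close> times \<open>g\<close> is a boundary
  \<open>d (Suc k) h\<close> modulo \<open>J k (F k)\<close>, and \<open>h\<close> represents the
  new class. The degree rises by one because \<open>L k\<close> is linear.\<close>

lemma socle_element_Suc:
  assumes g: "socle_element k \<delta> g" and k: "k < n"
  shows "\<exists>g'. socle_element (Suc k) (\<delta> + 1) g'"
proof -
  interpret d: Modules.module_hom scale scale "d (Suc k)" by (rule hom_d)
  note JF = subspace_ideal_mult[OF subspace_F]
  have gF: "g \<in> F k" and g_hom: "\<pi> k \<delta> g = g"
    and g_notin: "\<And>w. w \<in> Z k \<Longrightarrow> g - w \<notin> J k (F k)"
    and g_killed: "\<And>i. k \<le> i \<Longrightarrow> i < n \<Longrightarrow> \<exists>w\<in>Z k. scale (L i) g - w \<in> J k (F k)"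
    using g unfolding socle_element_def by auto
  obtain h where h: "h \<in> F (Suc k)" "scale (L k) g - d (Suc k) h \<in> J k (F k)"
    using g_killed[of k] k unfolding Z_def by blast
  \<comment> \<open>Passing to the homogeneous component keeps the congruence, since
    \<open>J k (F k)\<close> is graded; \<open>t\<close> is the remaining error.\<close>
  define g' where "g' = \<pi> (Suc k) (\<delta> + 1) h"
  define t where "t = d (Suc k) g' - scale (L k) g"
  have g'F: "g' \<in> F (Suc k)" unfolding g'_def by (rule \<pi>_in)
  have g'_hom: "\<pi> (Suc k) (\<delta> + 1) g' = g'" unfolding g'_def by (rule \<pi>_idem)
  have "\<pi> k (\<delta> + 1) (scale (L k) g - d (Suc k) h) + \<pi> k (\<delta> + 1) (d (Suc k) h)
      = scale (L k) g"
    using \<pi>_add[of k "\<delta> + 1" "scale (L k) g - d (Suc k) h" "d (Suc k) h"] \<pi>_L[OF k, of k \<delta> g] g_hom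
    by simp
  then have "- t = \<pi> k (\<delta> + 1) (scale (L k) g - d (Suc k) h)"
    unfolding t_def g'_def \<pi>_d[symmetric] by (simp add: algebra_simps)
  then have t: "t \<in> J k (F k)"
    using \<pi>_ideal_mult[of k _ k "\<delta> + 1"] h k subspace_neg[OF JF] by (metis less_imp_le minus_minus)
  have dg': "d (Suc k) g' = scale (L k) g + t" unfolding t_def by simp
  \<comment> \<open>If the new class were zero, applying \<open>d (Suc k)\<close> and cancelling
    \<open>L k\<close> by regularity would make the class of \<open>g\<close> zero.\<close>
  have "g' - z \<notin> J (Suc k) (F (Suc k))" if z: "z \<in> Z (Suc k)" for z
  proof
    assume "g' - z \<in> J (Suc k) (F (Suc k))"
    then have "d (Suc k) (g' - z) \<in> J (Suc k) (Z k)"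
      unfolding Z_def ideal_mult_image[OF hom_d] by blast
    moreover have "d (Suc k) (g' - z) = d (Suc k) g'"
      using z Z_Suc[of k z] k by (simp add: d.diff)
    ultimately obtain w r where w: "w \<in> Z k" and r: "r \<in> J k (Z k)"
      and eq: "d (Suc k) g' = scale (L k) w + r" by auto
    have "r \<in> J k (F k)" using r ideal_mult_mono[OF Z_subset] by blast
    moreover have "scale (L k) (g - w) = r - t"
      using eq dg' by (simp add: scale_right_diff_distrib algebra_simps)
    ultimately have "scale (L k) (g - w) \<in> J k (F k)"
      using t subspace_diff[OF JF] by metis
    moreover have "g - w \<in> F k" using gF w Z_subset subspace_diff[OF subspace_F] by blast
    ultimately have "g - w \<in> J k (F k)" using regular k by blast
    then show False using g_notin w by blast
  qed
  moreover have "\<exists>z\<in>Z (Suc k). scale (L i) g' - z \<in> J (Suc k) (F (Suc k))"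
    if i: "Suc k \<le> i" "i < n" for i
  proof -
    obtain w where w: "w \<in> Z k" "scale (L i) g - w \<in> J k (F k)"
      using g_killed[of i] i by auto
    define v where "v = scale (L i) g - w"
    \<comment> \<open>The part of \<open>d (Suc k) (scale (L i) g')\<close> not visibly in
      \<open>L k\<close> times \<open>Z k\<close>. It lies in both \<open>J k (F k)\<close> and
      \<open>Z k\<close>, so the Tor vanishing puts it in \<open>J k (Z k)\<close>; the whole
      boundary then lifts to some \<open>x\<close> in \<open>J (Suc k) (F (Suc k))\<close>.\<close>
    define y where "y = scale (L k) v + scale (L i) t"
    have eq: "d (Suc k) (scale (L i) g') = scale (L k) w + y"
      unfolding y_def v_def d.scale dg'
      by (simp add: scale_right_distrib scale_right_diff_distrib mult.commute)
    have "y \<in> J k (F k)"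
      unfolding y_def using w t v_def subspace_add[OF JF] subspace_scale[OF JF] by metis
    moreover have "y \<in> Z k"
    proof -
      have "d (Suc k) (scale (L i) g') \<in> Z k"
        unfolding Z_def using g'F subspace_scale[OF subspace_F] by blast
      moreover have "y = d (Suc k) (scale (L i) g') - scale (L k) w" using eq by simp
      ultimately show ?thesis
        using w subspace_diff[OF subspace_Z] subspace_scale[OF subspace_Z] by metis
    qed
    ultimately have "y \<in> J k (Z k)" using ideal_mult_Int_Z k by simp
    then have "d (Suc k) (scale (L i) g') \<in> J (Suc k) (Z k)"
      unfolding eq using w by auto
    then obtain x where x: "x \<in> J (Suc k) (F (Suc k))" "d (Suc k) (scale (L i) g') = d (Suc k) x"
      unfolding Z_def ideal_mult_image[OF hom_d] by blast
    have "x \<in> F (Suc k)" using x ideal_mult_subset[OF subspace_F] by blast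
    then have "scale (L i) g' - x \<in> Z (Suc k)"
      using x g'F Z_Suc[of k] k subspace_diff[OF subspace_F] subspace_scale[OF subspace_F]
      by (simp add: d.diff)
    moreover have "scale (L i) g' - (scale (L i) g' - x) \<in> J (Suc k) (F (Suc k))" using x by simp
    ultimately show ?thesis by blast
  qed
  ultimately have "socle_element (Suc k) (\<delta> + 1) g'"
    unfolding socle_element_def using g'F g'_hom by blast
  then show ?thesis ..
qed

text \<open>Since \<open>J 0 (F 0)\<close> is zero, the assumptions make \<open>f\<close> a socle
  element for k = 0. Each of the \<open>n\<close> steps raises the degree by one, and a nonzero
  class in \<open>F n\<close> has a nonzero representative.\<close>

lemma ex_nonzero_in_top_module:
  assumes "f \<in> F 0" "\<pi> 0 \<delta> f = f" "f \<notin> Z 0" "\<And>i. i < n \<Longrightarrow> scale (L i) f \<in> Z 0"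
  shows "\<exists>g. g \<in> F n \<and> \<pi> n (\<delta> + int n) g = g \<and> g \<noteq> 0"
proof -
  have "\<forall>w\<in>Z 0. f - w \<notin> J 0 (F 0)" using assms(3) by auto
  moreover have "\<exists>w\<in>Z 0. scale (L i) f - w \<in> J 0 (F 0)" if "i < n" for i
    using assms(4)[OF that] by (intro bexI[of _ "scale (L i) f"]) auto
  ultimately have "socle_element 0 \<delta> f"
    unfolding socle_element_def using assms(1,2) by blast
  then have "k \<le> n \<Longrightarrow> \<exists>g. socle_element k (\<delta> + int k) g" for k
  proof (induction k)
    case 0
    then show ?case by auto
  next
    case (Suc k)
    then obtain g where "socle_element k (\<delta> + int k) g" by auto
    from socle_element_Suc[OF this] Suc.prems show ?case by (simp add: ac_simps)
  qed
  then obtain g where g: "socle_element n (\<delta> + int n) g" by blast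
  have "g - 0 \<notin> J n (F n)"
    using g subspace_0[OF subspace_Z] unfolding socle_element_def by blast
  then have "g \<noteq> 0" using subspace_0[OF subspace_ideal_mult[OF subspace_F]] by auto
  then show ?thesis using g unfolding socle_element_def by blast
qed

end

section \<open>The polynomial ring\<close>

lemma poly_mapping_single_add_induct [case_names single add]:
  fixes p :: "'a \<Rightarrow>\<^sub>0 'b::comm_monoid_add"
  assumes "\<And>m c. P (Poly_Mapping.single m c)" and "\<And>p q. P p \<Longrightarrow> P q \<Longrightarrow> P (p + q)"
  shows "P p"
proof -
  have "P (\<Sum>m\<in>S. Poly_Mapping.single m (Poly_Mapping.lookup p m))" if "finite S" for S
    using that
  proof (induction S rule: finite_induct)
    case empty
    \<comment> \<open>Zero is a single term with coefficient 0 at an arbitrary key.\<close>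
    then show ?case using assms(1)[of undefined 0] by simp
  qed (simp add: assms)
  moreover have "p = (\<Sum>m\<in>Poly_Mapping.keys p. Poly_Mapping.single m (Poly_Mapping.lookup p m))"
    by (rule poly_mapping_eqI)
      (simp add: lookup_sum lookup_single when_def in_keys_iff)
  ultimately show ?thesis by (metis finite_keys)
qed

abbreviation Const :: "'k::zero \<Rightarrow> ('v, 'k) polyring" where
  "Const c \<equiv> Poly_Mapping.single 0 c"

definition X :: "'v \<Rightarrow> ('v, 'k::comm_ring_1) polyring" where
  "X i = Poly_Mapping.single (Poly_Mapping.single i 1) 1"

lemma single_eq_prod_X:
  fixes m :: "'v::finite \<Rightarrow>\<^sub>0 nat" and c :: "'k::comm_ring_1"
  shows "Poly_Mapping.single m c = Const c * (\<Prod>i\<in>UNIV. X i ^ Poly_Mapping.lookup m i)"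
proof -
  have pow: "X i ^ e = Poly_Mapping.single (Poly_Mapping.single i e) (1::'k)" for i :: 'v and e
    by (induction e) (simp_all add: X_def mult_single single_add[symmetric])
  have "(\<Prod>i\<in>S. Poly_Mapping.single (f i) (1::'k)) = Poly_Mapping.single (sum f S) 1"
    if "finite S" for S :: "'v set" and f :: "'v \<Rightarrow> 'v \<Rightarrow>\<^sub>0 nat"
    using that by (induction S rule: finite_induct) (simp_all add: mult_single)
  moreover have "(\<Sum>i\<in>UNIV. Poly_Mapping.single i (Poly_Mapping.lookup m i)) = m"
    by (rule poly_mapping_eqI) (simp add: lookup_sum lookup_single when_def)
  ultimately show ?thesis by (simp add: pow mult_single)
qed

lemma polyring_induct [case_names const X add mult]:
  fixes p :: "('v::finite, 'k::comm_ring_1) polyring"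
  assumes "\<And>c. P (Const c)" "\<And>i. P (X i)" "\<And>p q. P p \<Longrightarrow> P q \<Longrightarrow> P (p + q)"
    "\<And>p q. P p \<Longrightarrow> P q \<Longrightarrow> P (p * q)"
  shows "P p"
proof (induction p rule: poly_mapping_single_add_induct)
  case (single m c)
  have one: "P 1" using assms(1)[of 1] by simp
  have "P (X i ^ e)" for i e
    by (induction e) (simp_all add: one assms)
  note powers = this
  have "P (\<Prod>i\<in>S. X i ^ Poly_Mapping.lookup m i)" if "finite S" for S
    using that by (induction S rule: finite_induct) (simp_all add: one assms powers)
  then show ?case by (subst single_eq_prod_X) (simp add: assms)
qed (rule assms)

text \<open>The map \<iota> on coefficients lets one construction serve both evaluation at a vector
  and substitution of polynomials.\<close>

definition poly_subst :: "('k::comm_ring_1 \<Rightarrow> 'a::comm_ring_1) \<Rightarrow> ('v::finite \<Rightarrow> 'a) \<Rightarrow> ('v, 'k) polyring \<Rightarrow> 'a"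
  where "poly_subst \<iota> h p = (\<Sum>m\<in>Poly_Mapping.keys p.
    \<iota> (Poly_Mapping.lookup p m) * (\<Prod>i\<in>UNIV. h i ^ Poly_Mapping.lookup m i))"

lemma eval_at_eq_poly_subst: "eval_at x = poly_subst (\<lambda>c. c) (vec_nth x)"
  unfolding eval_at_def poly_subst_def by auto

context
  fixes \<iota> :: "'k::comm_ring_1 \<Rightarrow> 'a::comm_ring_1" and h :: "'v::finite \<Rightarrow> 'a"
  assumes hom: "comm_ring_hom \<iota>"
begin

interpretation comm_ring_hom \<iota> by (rule hom)

lemma poly_subst_add: "poly_subst \<iota> h (p + q) = poly_subst \<iota> h p + poly_subst \<iota> h q"
proof -
  have "poly_subst \<iota> h r = (\<Sum>m\<in>Poly_Mapping.keys p \<union> Poly_Mapping.keys q.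
      \<iota> (Poly_Mapping.lookup r m) * (\<Prod>i\<in>UNIV. h i ^ Poly_Mapping.lookup m i))"
    if "Poly_Mapping.keys r \<subseteq> Poly_Mapping.keys p \<union> Poly_Mapping.keys q" for r
    unfolding poly_subst_def
    by (rule sum.mono_neutral_left) (use that in \<open>auto simp: in_keys_iff\<close>)
  from this[of "p + q"] this[of p] this[of q] show ?thesis
    by (simp add: keys_add lookup_add hom_add distrib_right sum.distrib)
qed

lemma poly_subst_single:
  "poly_subst \<iota> h (Poly_Mapping.single m c) = \<iota> c * (\<Prod>i\<in>UNIV. h i ^ Poly_Mapping.lookup m i)"
  by (simp add: poly_subst_def)

lemma poly_subst_mult: "poly_subst \<iota> h (p * q) = poly_subst \<iota> h p * poly_subst \<iota> h q"
proof (induction p rule: poly_mapping_single_add_induct)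
  case (single m c)
  show ?case
  proof (induction q rule: poly_mapping_single_add_induct)
    case (single m' c')
    then show ?case
      by (simp add: mult_single poly_subst_single hom_mult lookup_add power_add prod.distrib ac_simps)
  qed (simp add: distrib_left poly_subst_add)
qed (simp add: distrib_right poly_subst_add)

lemma poly_subst_const: "poly_subst \<iota> h (Const c) = \<iota> c"
  by (simp add: poly_subst_single)

lemma poly_subst_X: "poly_subst \<iota> h (X i) = h i"
proof -
  have "(\<Prod>j\<in>UNIV. h j ^ (if i = j then Suc 0 else 0)) = (\<Prod>j\<in>UNIV. if i = j then h j else 1)"
    by (rule prod.cong) auto
  then show ?thesis
    by (simp add: X_def poly_subst_single lookup_single when_def)
qed

lemma comm_ring_hom_poly_subst: "comm_ring_hom (poly_subst \<iota> h)"
  using poly_subst_const[of 0] poly_subst_const[of 1]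
  by unfold_locales (simp_all add: poly_subst_add poly_subst_mult)

end

lemma comm_ring_hom_Const: "comm_ring_hom (Const :: 'k::comm_ring_1 \<Rightarrow> ('v, 'k) polyring)"
  by unfold_locales (simp_all add: single_add mult_single)

lemma comm_ring_hom_eval_at: "comm_ring_hom (eval_at x)"
  unfolding eval_at_eq_poly_subst by (rule comm_ring_hom_poly_subst) (unfold_locales; simp)

lemma eval_at_Const [simp]: "eval_at x (Const c) = c"
  and eval_at_X [simp]: "eval_at x (X i) = vec_nth x i"
  unfolding eval_at_eq_poly_subst
  by (rule poly_subst_const poly_subst_X; unfold_locales; simp)+

section \<open>Homogeneous polynomials and homogeneous components\<close>

lemma monomial_degree_add: "monomial_degree (m + m') = monomial_degree m + monomial_degree m'"
  by (simp add: monomial_degree_def lookup_add sum.distrib)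

lemma homogeneous_add: "homogeneous \<delta> p \<Longrightarrow> homogeneous \<delta> q \<Longrightarrow> homogeneous \<delta> (p + q)"
  unfolding homogeneous_def using keys_add[of p q] by auto

lemma homogeneous_mult:
  fixes p q :: "('v::finite, 'k::comm_ring_1) polyring"
  assumes "homogeneous \<delta> p" "homogeneous \<epsilon> q"
  shows "homogeneous (\<delta> + \<epsilon>) (p * q)"
  unfolding homogeneous_def
proof
  fix m assume "m \<in> Poly_Mapping.keys (p * q)"
  then obtain m1 m2 where "m = m1 + m2" "m1 \<in> Poly_Mapping.keys p" "m2 \<in> Poly_Mapping.keys q"
    using keys_mult[of p q] by auto
  then show "int (monomial_degree m) = \<delta> + \<epsilon>"
    using assms by (simp add: homogeneous_def monomial_degree_add)
qed

lemma homogeneous_Const: "homogeneous 0 (Const c)"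
  by (simp add: homogeneous_def monomial_degree_def)

lemma homogeneous_X: "homogeneous 1 (X i)"
  by (simp add: homogeneous_def monomial_degree_def X_def lookup_single when_def)

lemma homogeneous_sum:
  "(\<And>i. i \<in> S \<Longrightarrow> homogeneous \<delta> (f i)) \<Longrightarrow> homogeneous \<delta> (\<Sum>i\<in>S. f i)"
  by (induction S rule: infinite_finite_induct)
    (auto intro!: homogeneous_add simp: homogeneous_def[of _ 0])

lemma homogeneous_prod:
  fixes f :: "'i \<Rightarrow> ('v::finite, 'k::comm_ring_1) polyring"
  assumes "finite S" "\<And>i. i \<in> S \<Longrightarrow> homogeneous 1 (f i)"
  shows "homogeneous (int (card S)) (\<Prod>i\<in>S. f i)"
  using assms
proof (induction S rule: finite_induct)
  case empty
  then show ?case using homogeneous_Const[of "1::'k"] by simp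
next
  case (insert i S)
  then show ?case using homogeneous_mult[of 1 "f i" "int (card S)"] by simp
qed

lift_definition homogeneous_part :: "int \<Rightarrow> ('v::finite, 'k::zero) polyring \<Rightarrow> ('v, 'k) polyring"
  is "\<lambda>\<delta> p m. if int (monomial_degree m) = \<delta> then p m else 0"
  by (rule finite_subset) auto

lemma homogeneous_part_add:
  "homogeneous_part \<delta> (p + q) = homogeneous_part \<delta> p + homogeneous_part \<delta> q"
  by (rule poly_mapping_eqI) (simp add: homogeneous_part.rep_eq lookup_add)

lemma homogeneous_part_0 [simp]: "homogeneous_part \<delta> 0 = 0"
  by (rule poly_mapping_eqI) (simp add: homogeneous_part.rep_eq)

lemma homogeneous_part_sum:
  "homogeneous_part \<delta> (\<Sum>i\<in>S. f i) = (\<Sum>i\<in>S. homogeneous_part \<delta> (f i))"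
  by (induction S rule: infinite_finite_induct) (simp_all add: homogeneous_part_add)

lemma homogeneous_homogeneous_part: "homogeneous \<delta> (homogeneous_part \<delta> p)"
  by (auto simp: homogeneous_def in_keys_iff homogeneous_part.rep_eq split: if_splits)

lemma homogeneous_part_homogeneous:
  "homogeneous \<epsilon> p \<Longrightarrow> homogeneous_part \<delta> p = (if \<delta> = \<epsilon> then p else 0)"
  by (rule poly_mapping_eqI)
    (auto simp: homogeneous_part.rep_eq homogeneous_def in_keys_iff)

text \<open>Used to turn a nonzero component into an upper bound for a shift.\<close>

lemma homogeneous_part_negative: "\<delta> < 0 \<Longrightarrow> homogeneous_part \<delta> p = 0"
  by (rule poly_mapping_eqI) (auto simp: homogeneous_part.rep_eq)

text \<open>By additivity in \<open>q\<close> a single term suffices, and that is homogeneous. This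
  makes the graded matrices and the \<open>L j\<close> compatible with the projections.\<close>

lemma homogeneous_part_mult:
  fixes p q :: "('v::finite, 'k::comm_ring_1) polyring"
  assumes "homogeneous \<epsilon> p"
  shows "homogeneous_part (\<delta> + \<epsilon>) (p * q) = p * homogeneous_part \<delta> q"
proof (induction q rule: poly_mapping_single_add_induct)
  case (single m c)
  have "homogeneous (int (monomial_degree m)) (Poly_Mapping.single m c)"
    by (simp add: homogeneous_def)
  from homogeneous_part_homogeneous[OF this]
    homogeneous_part_homogeneous[OF homogeneous_mult[OF assms this]]
  show ?case by auto
qed (simp add: homogeneous_part_add distrib_left)

section \<open>Linear nonzerodivisors and elimination of a variable\<close>

lemma X_mult_lookup:
  fixes p :: "('v::finite, 'k::comm_ring_1) polyring"
  shows "Poly_Mapping.lookup (X i * p) (Poly_Mapping.single i 1 + m) = Poly_Mapping.lookup p m"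
proof (induction p rule: poly_mapping_single_add_induct)
  case (single m' c)
  then show ?case by (simp add: X_def mult_single lookup_single)
qed (simp add: distrib_left lookup_add)

text \<open>Compare the coefficients at a monomial with the largest possible exponent of the
  variable \<open>i\<close>.\<close>

lemma X_minus_X_mult_eq_0:
  fixes q :: "('v::finite, 'k::comm_ring_1) polyring"
  assumes "i \<noteq> j" "(X i - Const c * X j) * q = 0"
  shows "q = 0"
proof (rule ccontr)
  assume "q \<noteq> 0"
  then have ne: "Poly_Mapping.keys q \<noteq> {}" by simp
  define e where "e = Max ((\<lambda>m. Poly_Mapping.lookup m i) ` Poly_Mapping.keys q)"
  have "e \<in> (\<lambda>m. Poly_Mapping.lookup m i) ` Poly_Mapping.keys q"
    unfolding e_def using ne by (intro Max_in) auto
  then obtain m where m: "m \<in> Poly_Mapping.keys q" "Poly_Mapping.lookup m i = e" by auto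
  have le: "Poly_Mapping.lookup m' i \<le> e" if "m' \<in> Poly_Mapping.keys q" for m'
    unfolding e_def using that by (intro Max_ge) auto
  have eq: "X i * q = X j * (Const c * q)"
    using assms(2) by (simp add: algebra_simps)
  have "Poly_Mapping.single i 1 + m \<in> Poly_Mapping.keys (X i * q)"
    using m unfolding in_keys_iff X_mult_lookup by simp
  then obtain m1 m2 where m12: "Poly_Mapping.single i 1 + m = m1 + m2"
      "m1 \<in> Poly_Mapping.keys (X j :: ('v, 'k) polyring)" "m2 \<in> Poly_Mapping.keys (Const c * q)"
    unfolding eq using keys_mult[of "X j" "Const c * q"] by blast
  have "m2 \<in> Poly_Mapping.keys q"
    using m12(3) keys_mult[of "Const c" q] by (auto split: if_splits)
  moreover have "m1 = Poly_Mapping.single j 1" using m12(2) by (auto simp: X_def)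
  then have "Poly_Mapping.lookup m2 i = e + 1"
    using arg_cong[OF m12(1), of "\<lambda>m. Poly_Mapping.lookup m i"] m assms(1)
    by (simp add: lookup_add lookup_single)
  ultimately show False using le by force
qed

text \<open>When \<open>x\<^sub>i\<close> does not occur in \<open>r\<close>, the ideal of \<open>x\<^sub>i - r\<close> is the kernel of this ring homomorphism;
  regularity of the linear equations of a point is read off from such kernels.\<close>

definition subst_var :: "'v::finite \<Rightarrow> ('v, 'k::comm_ring_1) polyring \<Rightarrow> ('v, 'k) polyring \<Rightarrow> ('v, 'k) polyring"
  where "subst_var i r = poly_subst Const (\<lambda>l. if l = i then r else X l)"

lemma comm_ring_hom_subst_var: "comm_ring_hom (subst_var i r)"
  unfolding subst_var_def by (rule comm_ring_hom_poly_subst[OF comm_ring_hom_Const])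

lemma subst_var_Const: "subst_var i r (Const c) = Const c"
  unfolding subst_var_def by (rule poly_subst_const[OF comm_ring_hom_Const])

lemma subst_var_X: "subst_var i r (X l) = (if l = i then r else X l)"
  unfolding subst_var_def by (rule poly_subst_X[OF comm_ring_hom_Const])

text \<open>Modulo \<open>X i - r\<close> the substitution agrees with the identity on constants and
  variables, hence everywhere.\<close>

lemma dvd_diff_subst_var: "(X i - r) dvd p - subst_var i r p"
proof -
  interpret comm_ring_hom "subst_var i r" by (rule comm_ring_hom_subst_var)
  show ?thesis
  proof (induction p rule: polyring_induct)
    case (add p q)
    have "p + q - subst_var i r (p + q) = (p - subst_var i r p) + (q - subst_var i r q)"
      unfolding hom_add by (simp only: add_diff_add)
    then show ?case using dvd_add[OF add] by (simp only:)
  next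
    case (mult p q)
    have "p * q - subst_var i r (p * q) =
        (p - subst_var i r p) * q + subst_var i r p * (q - subst_var i r q)"
      by (simp add: hom_mult algebra_simps)
    then show ?case using mult by simp
  qed (auto simp: subst_var_Const subst_var_X)
qed

section \<open>Separators of projective points\<close>

definition linear_form :: "('v::finite \<Rightarrow> 'k::comm_ring_1) \<Rightarrow> ('v, 'k) polyring" where
  "linear_form c = (\<Sum>i\<in>UNIV. Const (c i) * X i)"

lemma homogeneous_linear_form: "homogeneous 1 (linear_form c)"
  unfolding linear_form_def
  using homogeneous_mult[OF homogeneous_Const homogeneous_X] by (intro homogeneous_sum) simp

lemma eval_at_linear_form: "eval_at x (linear_form c) = (\<Sum>i\<in>UNIV. c i * vec_nth x i)"
proof -
  interpret comm_ring_hom "eval_at x" by (rule comm_ring_hom_eval_at)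
  show ?thesis by (simp add: linear_form_def hom_sum hom_mult)
qed

lemma separating_linear_form:
  fixes S :: "('k::field ^ 'v::finite) set"
  assumes "vec.subspace S" "x \<notin> S"
  shows "\<exists>c. (\<forall>y\<in>S. eval_at y (linear_form c) = 0) \<and> eval_at x (linear_form c) \<noteq> 0"
proof -
  obtain B where B: "B \<subseteq> S" "vec.independent B" "S \<subseteq> vec.span B"
    using vec.basis_exists[of S] by metis
  have span: "vec.span B = S"
    using B assms(1) vec.span_minimal by blast
  then have "vec.independent (insert x B)"
    using B assms(2) vec.independent_insert[of x B] by auto
  \<comment> \<open>Here \<open>1\<close> is the vector with all coordinates 1, so each coordinate
    of \<open>g\<close> is a separating form and the index \<open>l\<close> below may be
    arbitrary.\<close>
  then obtain g where g: "Vector_Spaces.linear (*s) (*s) g"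
      "\<forall>y\<in>insert x B. g y = (if y = x then 1 else 0 :: 'k ^ 'v)"
    using vec.linear_independent_extend[of "insert x B" "\<lambda>y. if y = x then 1 else 0"] by auto
  have xB: "x \<notin> B" using assms(2) B by blast
  have g0: "g y = 0" if "y \<in> S" for y
  proof -
    have "B \<subseteq> {y. g y = 0}" using g(2) xB by auto
    moreover have "vec.subspace {y. g y = 0}"
      using vec.linear_subspace_kernel[OF g(1)] .
    ultimately show ?thesis using vec.span_minimal span that by blast
  qed
  define l :: 'v where "l = undefined"
  define c where "c = vec_nth (vec_nth (matrix g) l)"
  have "eval_at y (linear_form c) = vec_nth (matrix g *v y) l" for y
    by (simp add: eval_at_linear_form c_def matrix_vector_mult_def)
  then have "eval_at y (linear_form c) = vec_nth (g y) l" for y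
    unfolding matrix_works[OF g(1)] .
  then show ?thesis using g0 g(2) by (intro exI[of _ c]) simp
qed

lemma proj_point_generator:
  assumes "P \<in> proj_points"
  obtains p where "p \<noteq> 0" "P = vec.span {p}"
proof -
  have P: "vec.subspace P" "vec.dim P = 1" using assms by (auto simp: proj_points_def)
  obtain B where B: "B \<subseteq> P" "vec.independent B" "P \<subseteq> vec.span B" "card B = vec.dim P"
    using vec.basis_exists[of P] by metis
  then obtain p where p: "B = {p}" using P card_1_singletonE by metis
  have "p \<noteq> 0" using B(2) p vec.dependent_zero by blast
  moreover have "P = vec.span {p}" using B p P vec.span_minimal by blast
  ultimately show ?thesis using that by blast
qed

text \<open>A line through the origin is spanned by any of its nonzero vectors.\<close>

lemma proj_points_inter:
  assumes "P \<in> proj_points" "Q \<in> proj_points" "x \<in> P" "x \<in> Q" "x \<noteq> 0"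
  shows "P = Q"
proof -
  have "R = vec.span {x}" if R: "R \<in> proj_points" "x \<in> R" for R
  proof -
    obtain p where p: "R = vec.span {p}" using R(1) by (rule proj_point_generator)
    obtain t where t: "x = t *s p"
      using R(2) unfolding p vec.span_singleton by auto
    then have "t \<noteq> 0" using assms(5) by auto
    then have "p = inverse t *s x" unfolding t by (simp add: vector_smult_assoc)
    then have "p \<in> vec.span {x}" by (metis vec.span_base vec.span_scale singletonI)
    then have "R \<subseteq> vec.span {x}" unfolding p by (simp add: vec.span_minimal)
    moreover have "vec.span {x} \<subseteq> R"
      using R vec.span_minimal unfolding p by (metis empty_subsetI insert_subset vec.subspace_span)
    ultimately show ?thesis by blast
  qed
  then show ?thesis using assms by metis
qed

text \<open>Drop one vector from a basis of the whole space. This ensures that the maximum in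
  \<open>hyp\<close> is taken over a nonempty set.\<close>

lemma proj_hyperplanes_nonempty: "proj_hyperplanes \<noteq> ({} :: ('k::field ^ 'v::finite) set set)"
proof -
  obtain B :: "('k ^ 'v) set" where B: "vec.independent B" "card B = CARD('v)"
    using vec.basis_exists[of UNIV] vec.dim_UNIV by (metis vec_dim_card)
  then obtain b where b: "b \<in> B" by (metis card.empty equals0I zero_less_card_finite less_irrefl)
  have "vec.independent (B - {b})" using B(1) vec.independent_mono by blast
  then have "vec.dim (vec.span (B - {b})) = CARD('v) - 1"
    using vec.dim_span_eq_card_independent b B(2) by (metis card_Diff_singleton)
  then show ?thesis unfolding proj_hyperplanes_def using vec.subspace_span by blast
qed

text \<open>One vector \<open>p\<close> on \<open>P\<close> with nonzero value keeps
  \<open>f\<close> out of the ideal, whereas at the other points \<open>f\<close> has to vanish on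
  every vector.\<close>

lemma ex_separator:
  fixes \<Gamma> :: "('k::field ^ 'v::finite) set set"
  assumes \<Gamma>: "\<Gamma> \<subseteq> proj_points" "finite \<Gamma>"
    and nondeg: "\<not> (\<exists>H\<in>proj_hyperplanes. \<forall>P\<in>\<Gamma>. P \<subseteq> H)"
  shows "\<exists>P\<in>\<Gamma>. \<exists>p\<in>P. \<exists>f. homogeneous (int (min_distance \<Gamma>)) f \<and> eval_at p f \<noteq> 0 \<and>
    (\<forall>Q\<in>\<Gamma> - {P}. \<forall>x\<in>Q. eval_at x f = 0)"
proof -
  let ?count = "\<lambda>H. card {P \<in> \<Gamma>. P \<subseteq> H}"
  \<comment> \<open>There may be infinitely many hyperplanes, but the counts are bounded by
    \<open>card \<Gamma>\<close>, so the maximum is attained.\<close>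
  have "?count ` proj_hyperplanes \<subseteq> {..card \<Gamma>}" using \<Gamma>(2) by (auto intro: card_mono)
  then have "finite (?count ` proj_hyperplanes)" by (rule finite_subset) simp
  then have "hyp \<Gamma> \<in> ?count ` proj_hyperplanes"
    unfolding hyp_def using proj_hyperplanes_nonempty by (intro Max_in) auto
  then obtain H where H: "H \<in> proj_hyperplanes" "hyp \<Gamma> = ?count H" by auto
  define \<Delta> where "\<Delta> = {P \<in> \<Gamma>. \<not> P \<subseteq> H}"
  have "\<Delta> = \<Gamma> - {P \<in> \<Gamma>. P \<subseteq> H}" unfolding \<Delta>_def by blast
  then have card_\<Delta>: "card \<Delta> = min_distance \<Gamma>"
    unfolding min_distance_def H(2) using \<Gamma>(2) by (simp add: card_Diff_subset)
  have fin: "finite \<Delta>" unfolding \<Delta>_def using \<Gamma>(2) by simp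
  obtain P where P: "P \<in> \<Gamma>" "P \<in> \<Delta>" using nondeg H(1) unfolding \<Delta>_def by blast
  obtain p where p: "p \<in> P" "p \<notin> H" using P unfolding \<Delta>_def by blast
  have H_sub: "vec.subspace H" using H(1) unfolding proj_hyperplanes_def by blast
  then have "p \<noteq> 0" using p(2) vec.subspace_0 by blast
  have "\<exists>c. (\<forall>y\<in>Q. eval_at y (linear_form c) = 0) \<and> eval_at p (linear_form c) \<noteq> 0"
    if Q: "Q \<in> \<Delta> - {P}" for Q
  proof (rule separating_linear_form)
    have "Q \<in> proj_points" "P \<in> proj_points" using Q P \<Gamma>(1) unfolding \<Delta>_def by auto
    then show "p \<notin> Q" using proj_points_inter p(1) \<open>p \<noteq> 0\<close> Q by blast
    show "vec.subspace Q" using \<open>Q \<in> proj_points\<close> unfolding proj_points_def by blast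
  qed
  then obtain c where c: "\<And>Q y. Q \<in> \<Delta> - {P} \<Longrightarrow> y \<in> Q \<Longrightarrow> eval_at y (linear_form (c Q)) = 0"
      "\<And>Q. Q \<in> \<Delta> - {P} \<Longrightarrow> eval_at p (linear_form (c Q)) \<noteq> 0" by metis
  obtain h where h: "\<And>y. y \<in> H \<Longrightarrow> eval_at y (linear_form h) = 0" "eval_at p (linear_form h) \<noteq> 0"
    using separating_linear_form[OF H_sub p(2)] by blast
  define f where "f = linear_form h * (\<Prod>Q\<in>\<Delta> - {P}. linear_form (c Q))"
  have eval_f: "eval_at x f = eval_at x (linear_form h) * (\<Prod>Q\<in>\<Delta> - {P}. eval_at x (linear_form (c Q)))" for x
  proof -
    interpret comm_ring_hom "eval_at x" by (rule comm_ring_hom_eval_at)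
    show ?thesis unfolding f_def by (simp add: hom_mult hom_prod)
  qed
  \<comment> \<open>The factor for \<open>H\<close> makes up for the omitted point \<open>P\<close>,
    so there are \<open>card \<Delta>\<close> linear factors.\<close>
  have "1 + int (card (\<Delta> - {P})) = int (min_distance \<Gamma>)"
    using card_\<Delta> P(2) fin by (metis card.remove of_nat_Suc)
  then have "homogeneous (int (min_distance \<Gamma>)) f"
    unfolding f_def
    using homogeneous_mult[OF homogeneous_linear_form homogeneous_prod[of "\<Delta> - {P}"]]
      homogeneous_linear_form fin by (metis finite_Diff)
  moreover have "eval_at p f \<noteq> 0" using h c fin by (simp add: eval_f)
  moreover have "eval_at x f = 0" if Q: "Q \<in> \<Gamma> - {P}" "x \<in> Q" for Q x
  proof (cases "Q \<in> \<Delta>")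
    case True
    then have "(\<Prod>Q\<in>\<Delta> - {P}. eval_at x (linear_form (c Q))) = 0"
      using Q c(1) fin by (intro prod_zero) auto
    then show ?thesis by (simp add: eval_f)
  next
    case False
    then have "x \<in> H" using Q unfolding \<Delta>_def by auto
    then show ?thesis using h by (simp add: eval_f)
  qed
  ultimately show ?thesis using P p by blast
qed

section \<open>Graded free modules\<close>

definition scale_fun :: "'r::comm_ring_1 \<Rightarrow> (nat \<Rightarrow> 'r) \<Rightarrow> nat \<Rightarrow> 'r" where
  "scale_fun c v = (\<lambda>i. c * v i)"

lemma module_scale_fun: "Modules.module scale_fun"
  by unfold_locales (simp_all add: scale_fun_def fun_eq_iff algebra_simps)

text \<open>Column vectors of length \<open>r\<close> as functions vanishing from \<open>r\<close> on: in contrast to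
  \<^term>\<open>carrier_vec r\<close>, they live in a single abelian group for all \<open>r\<close>.\<close>

definition free_module :: "nat \<Rightarrow> (nat \<Rightarrow> 'r::zero) set" where
  "free_module r = {v. \<forall>i\<ge>r. v i = 0}"

definition mat_fun :: "'r::comm_ring_1 mat \<Rightarrow> (nat \<Rightarrow> 'r) \<Rightarrow> nat \<Rightarrow> 'r" where
  "mat_fun M v = (\<lambda>i. if i < dim_row M then \<Sum>j<dim_col M. M $$ (i, j) * v j else 0)"

lemma subspace_free_module: "Modules.module.subspace scale_fun (free_module r)"
  unfolding Modules.module.subspace_def[OF module_scale_fun]
  by (simp add: free_module_def scale_fun_def)

lemma module_hom_mat_fun: "Modules.module_hom scale_fun scale_fun (mat_fun M)"
proof -
  interpret Modules.module scale_fun by (rule module_scale_fun)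
  show ?thesis
    by unfold_locales
      (simp_all add: mat_fun_def scale_fun_def fun_eq_iff sum.distrib distrib_left
        sum_distrib_left mult.left_commute)
qed

lemma mat_fun_in: "mat_fun M v \<in> free_module (dim_row M)"
  by (simp add: mat_fun_def free_module_def)

section \<open>Dictionary between column vectors and functions\<close>

lemma mult_mat_vec_fun:
  "M *\<^sub>v Matrix.vec (dim_col M) v = Matrix.vec (dim_row M) (mat_fun M v)"
  by (rule eq_vecI)
    (auto simp: mat_fun_def scalar_prod_def lessThan_atLeast0 intro!: sum.cong)

lemma vec_fun_eq_iff:
  "v \<in> free_module r \<Longrightarrow> w \<in> free_module r \<Longrightarrow> Matrix.vec r v = Matrix.vec r w \<longleftrightarrow> v = w"
  unfolding free_module_def fun_eq_iff by (auto simp: vec_eq_iff) (metis not_le)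

lemma mat_kernel_fun:
  assumes "v \<in> free_module (dim_col M)"
  shows "Matrix.vec (dim_col M) v \<in> mat_kernel M \<longleftrightarrow> mat_fun M v = 0"
proof -
  have "(0 :: nat \<Rightarrow> 'a) \<in> free_module (dim_row M)" by (simp add: free_module_def)
  moreover have "0\<^sub>v (dim_row M) = Matrix.vec (dim_row M) (0 :: nat \<Rightarrow> 'a)" by (rule eq_vecI) auto
  ultimately show ?thesis
    unfolding mat_kernel_def using vec_fun_eq_iff[OF mat_fun_in]
    by (simp add: mult_mat_vec_fun)
qed

lemma mat_image_fun:
  assumes "v \<in> free_module (dim_row M)"
  shows "Matrix.vec (dim_row M) v \<in> mat_image M \<longleftrightarrow> v \<in> mat_fun M ` free_module (dim_col M)"
proof
  assume "Matrix.vec (dim_row M) v \<in> mat_image M"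
  then obtain w where w: "w \<in> carrier_vec (dim_col M)" "Matrix.vec (dim_row M) v = M *\<^sub>v w"
    unfolding mat_image_def by auto
  define u where "u = (\<lambda>i. if i < dim_col M then vec_index w i else 0)"
  have "w = Matrix.vec (dim_col M) u" using w(1) by (intro eq_vecI) (auto simp: u_def)
  then have "Matrix.vec (dim_row M) v = Matrix.vec (dim_row M) (mat_fun M u)"
    using w(2) mult_mat_vec_fun by metis
  then have "v = mat_fun M u" using vec_fun_eq_iff[OF assms mat_fun_in] by blast
  moreover have "u \<in> free_module (dim_col M)" by (simp add: u_def free_module_def)
  ultimately show "v \<in> mat_fun M ` free_module (dim_col M)" by blast
next
  assume "v \<in> mat_fun M ` free_module (dim_col M)"
  then obtain u where "v = mat_fun M u" by blast
  then show "Matrix.vec (dim_row M) v \<in> mat_image M"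
    unfolding mat_image_def using mult_mat_vec_fun[of M u] by (auto intro!: exI[of _ "Matrix.vec (dim_col M) u"])
qed

section \<open>The linear equations of a projective point form a regular sequence\<close>

locale line_equations =
  fixes n :: nat and ix :: "nat \<Rightarrow> 'v::finite" and i0 :: 'v and c :: "nat \<Rightarrow> 'k::comm_ring_1"
  assumes inj: "inj_on ix {..<n}" and ix_neq: "j < n \<Longrightarrow> ix j \<noteq> i0"
begin

text \<open>Equations of a point with nonzero coordinate \<open>i0\<close>, solved for the other
  coordinates: for j < n the variable \<open>X (ix j)\<close> occurs in \<open>L j\<close> but in no
  other \<open>L i\<close> with i < n.\<close>

definition L :: "nat \<Rightarrow> ('v, 'k) polyring" where
  "L j = X (ix j) - Const (c j) * X i0"

text \<open>Eliminates the first \<open>j\<close> of these variables. For j \<le> n its kernel is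
  the ideal of \<open>L 0\<close>, ..., \<open>L (j - 1)\<close>;
  \<open>diff_\<sigma>_in_ideal_mult\<close> and \<open>\<sigma>_ideal_mult\<close> give the two
  inclusions coordinatewise.\<close>

primrec \<sigma> :: "nat \<Rightarrow> ('v, 'k) polyring \<Rightarrow> ('v, 'k) polyring" where
  "\<sigma> 0 p = p"
| "\<sigma> (Suc j) p = subst_var (ix j) (Const (c j) * X i0) (\<sigma> j p)"

sublocale module_with_sequence scale_fun L
  using module_scale_fun by (simp add: module_with_sequence_def)

lemma comm_ring_hom_\<sigma>: "comm_ring_hom (\<sigma> j)"
proof (induction j)
  case 0
  show ?case by unfold_locales auto
next
  case (Suc j)
  interpret a: comm_ring_hom "\<sigma> j" by (rule Suc)
  interpret b: comm_ring_hom "subst_var (ix j) (Const (c j) * X i0)" by (rule comm_ring_hom_subst_var)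
  show ?case
    by unfold_locales (simp_all add: a.hom_add a.hom_mult b.hom_add b.hom_mult)
qed

lemma subst_var_L:
  assumes "i < n" "j < n"
  shows "subst_var (ix j) (Const (c j) * X i0) (L i) = (if i = j then 0 else L i)"
proof -
  interpret comm_ring_hom "subst_var (ix j) (Const (c j) * X i0)" by (rule comm_ring_hom_subst_var)
  show ?thesis
    using assms inj ix_neq[of j] unfolding L_def inj_on_def
    by (auto simp: hom_minus hom_mult subst_var_X subst_var_Const)
qed

lemma \<sigma>_L: "i < n \<Longrightarrow> j \<le> n \<Longrightarrow> \<sigma> j (L i) = (if i < j then 0 else L i)"
proof (induction j)
  case (Suc j)
  interpret comm_ring_hom "subst_var (ix j) (Const (c j) * X i0)" by (rule comm_ring_hom_subst_var)
  show ?case using Suc by (simp add: subst_var_L)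
qed simp

lemma \<sigma>_in_free_module: "v \<in> free_module r \<Longrightarrow> (\<lambda>i. \<sigma> j (v i)) \<in> free_module r"
proof -
  interpret comm_ring_hom "\<sigma> j" by (rule comm_ring_hom_\<sigma>)
  show "v \<in> free_module r \<Longrightarrow> ?thesis" by (simp add: free_module_def)
qed

text \<open>The difference telescopes, and the substitution for \<open>X (ix j)\<close> contributes
  a multiple of \<open>L j\<close>.\<close>

lemma diff_\<sigma>_in_ideal_mult:
  "v \<in> free_module r \<Longrightarrow> v - (\<lambda>i. \<sigma> j (v i)) \<in> ideal_mult j (free_module r)"
proof (induction j)
  case 0
  then show ?case by (simp add: fun_eq_iff)
next
  case (Suc j)
  define w where "w = (\<lambda>i. \<sigma> j (v i))"
  have w: "w \<in> free_module r" unfolding w_def by (rule \<sigma>_in_free_module[OF Suc.prems])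
  have "\<exists>q. w i - \<sigma> (Suc j) (v i) = L j * q" for i
    using dvd_diff_subst_var[of "ix j" "Const (c j) * X i0" "w i"]
    unfolding w_def L_def dvd_def by simp
  then obtain q where q: "\<And>i. w i - \<sigma> (Suc j) (v i) = L j * q i" by metis
  \<comment> \<open>Past \<open>r\<close> the quotients \<open>q i\<close> are arbitrary; cutting
    them off keeps \<open>u\<close> in the free module.\<close>
  define u where "u = (\<lambda>i. if i < r then q i else 0)"
  have u: "u \<in> free_module r" by (simp add: u_def free_module_def)
  have \<sigma>_in: "(\<lambda>i. \<sigma> (Suc j) (v i)) \<in> free_module r" by (rule \<sigma>_in_free_module[OF Suc.prems])
  have "v i - \<sigma> (Suc j) (v i) = L j * u i + (v i - w i)" for i
  proof (cases "i < r")
    case True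
    then show ?thesis using q[of i] by (simp add: u_def algebra_simps)
  next
    case False
    then have "v i = 0" "w i = 0" "\<sigma> (Suc j) (v i) = 0"
      using Suc.prems w \<sigma>_in unfolding free_module_def by (auto simp del: \<sigma>.simps)
    then show ?thesis using False by (simp add: u_def)
  qed
  then have "v - (\<lambda>i. \<sigma> (Suc j) (v i)) = scale_fun (L j) u + (v - w)"
    by (simp add: fun_eq_iff scale_fun_def)
  then show ?case
    using ideal_mult_SucI[OF u] Suc.IH[OF Suc.prems] unfolding w_def by metis
qed

text \<open>The separate index \<open>k\<close> lets the induction run with
  \<open>\<sigma> j\<close> fixed, which kills every \<open>L i\<close> with i < k.\<close>

lemma \<sigma>_ideal_mult: "j \<le> n \<Longrightarrow> k \<le> j \<Longrightarrow> v \<in> ideal_mult k (free_module r) \<Longrightarrow> \<sigma> j (v i) = 0"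
proof (induction k arbitrary: v)
  case 0
  interpret comm_ring_hom "\<sigma> j" by (rule comm_ring_hom_\<sigma>)
  show ?case using 0 by simp
next
  case (Suc k)
  interpret comm_ring_hom "\<sigma> j" by (rule comm_ring_hom_\<sigma>)
  obtain u w where "v = scale_fun (L k) u + w" "w \<in> ideal_mult k (free_module r)"
    using Suc.prems by auto
  moreover from this have "\<sigma> j (w i) = 0" using Suc by simp
  ultimately show ?case
    using Suc.prems(1,2) by (simp add: scale_fun_def hom_add hom_mult \<sigma>_L)
qed

text \<open>The homomorphism \<open>\<sigma> j\<close> kills the submodule and fixes the
  nonzerodivisor \<open>L j\<close>. Hence it kills \<open>v\<close>, and \<open>v\<close> equals
  its own difference from its image under \<open>\<sigma> j\<close>.\<close>

lemma regular_free_module: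
  assumes "j < n" "v \<in> free_module r" "scale_fun (L j) v \<in> ideal_mult j (free_module r)"
  shows "v \<in> ideal_mult j (free_module r)"
proof -
  interpret comm_ring_hom "\<sigma> j" by (rule comm_ring_hom_\<sigma>)
  have "\<sigma> j (v i) = 0" for i
  proof -
    have "L j * \<sigma> j (v i) = 0"
      using \<sigma>_ideal_mult[OF _ _ assms(3), of j i] assms(1)
      by (simp add: scale_fun_def hom_mult \<sigma>_L)
    then show ?thesis
      unfolding L_def using X_minus_X_mult_eq_0[OF ix_neq[OF assms(1)]] by blast
  qed
  then show ?thesis
    using diff_\<sigma>_in_ideal_mult[OF assms(2), of j] by (simp add: zero_fun_def[symmetric])
qed

lemma homogeneous_L: "homogeneous 1 (L j)"
proof -
  have "L j = X (ix j) + Const (- c j) * X i0" by (simp add: L_def single_uminus)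
  then show ?thesis
    using homogeneous_add[OF homogeneous_X, of "Const (- c j) * X i0" "ix j"]
      homogeneous_mult[OF homogeneous_Const[of "- c j"] homogeneous_X[of i0]] by simp
qed

end

section \<open>The minimum socle degree\<close>

lemma min_socle_degree_le:
  fixes I :: "('v::finite, 'k::field) polyring set"
  assumes res: "graded_free_resolution n I a D" and n: "1 \<le> n"
    and lines: "line_equations n ix i0"
    and f: "homogeneous \<delta> f" "f \<notin> I" "\<And>j. j < n \<Longrightarrow> line_equations.L ix i0 c j * f \<in> I"
  shows "min_socle_degree n a \<le> \<delta>"
proof -
  interpret lines: line_equations n ix i0 c by (rule lines)
  \<comment> \<open>The resolution is extended by zero modules and zero maps beyond
    \<open>n\<close>, where \<open>a\<close> and \<open>D\<close> are unspecified.\<close>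
  define a' where "a' k = (if k \<le> n then a k else [])" for k
  define F :: "nat \<Rightarrow> (nat \<Rightarrow> ('v, 'k) polyring) set"
    where "F k = free_module (length (a' k))" for k
  define d where "d k = (if k \<le> n then mat_fun (D k) else (\<lambda>_. 0))" for k
  \<comment> \<open>In the summand with shift \<open>a' k ! i\<close>, degree \<epsilon> means
    polynomials of degree \<epsilon> minus that shift.\<close>
  define \<pi> :: "nat \<Rightarrow> int \<Rightarrow> (nat \<Rightarrow> ('v, 'k) polyring) \<Rightarrow> nat \<Rightarrow> ('v, 'k) polyring"
    where "\<pi> k \<epsilon> v = (\<lambda>i. if i < length (a' k) then homogeneous_part (\<epsilon> - a' k ! i) (v i) else 0)"
    for k \<epsilon> v
  have a0: "a 0 = [0]"
    and im: "mat_image (D 1) = {v \<in> carrier_vec 1. vec_index v 0 \<in> I}"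
    and ker: "\<And>k. Suc k < n \<Longrightarrow> mat_kernel (D (Suc k)) = mat_image (D (Suc (Suc k)))"
    and ker_n: "mat_kernel (D n) = {0\<^sub>v (length (a n))}"
    using res unfolding graded_free_resolution_def by auto
  have gr: "graded_map (a (Suc k)) (a k) (D (Suc k))" if "Suc k \<le> n" for k
  proof -
    have "\<forall>k\<in>{1..n}. graded_map (a k) (a (k - 1)) (D k)"
      using res unfolding graded_free_resolution_def by blast
    from bspec[OF this, of "Suc k"] that show ?thesis by simp
  qed
  have dims: "dim_row (D (Suc k)) = length (a k)" "dim_col (D (Suc k)) = length (a (Suc k))"
    if "Suc k \<le> n" for k
    using gr[OF that] unfolding graded_map_def by auto
  have zero_in: "(0 :: nat \<Rightarrow> ('v, 'k) polyring) \<in> free_module r" for r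
    by (simp add: free_module_def)
  interpret graded_exact_complex scale_fun lines.L n F d \<pi>
  proof (intro graded_exact_complex.intro graded_exact_complex_axioms.intro)
    show "module_with_sequence scale_fun"
      unfolding module_with_sequence_def by (rule module_scale_fun)
    show "Modules.module.subspace scale_fun (F k)" for k
      unfolding F_def by (rule subspace_free_module)
    show "F (Suc n) = {0}"
      by (auto simp: F_def a'_def free_module_def fun_eq_iff)
    \<comment> \<open>The zero map is presented by an empty matrix to obtain its linearity.\<close>
    have "mat_fun (0\<^sub>m 0 0) = (\<lambda>_. 0 :: nat \<Rightarrow> ('v, 'k) polyring)"
      by (simp add: mat_fun_def fun_eq_iff)
    then have "Modules.module_hom scale_fun scale_fun (\<lambda>_. 0 :: nat \<Rightarrow> ('v, 'k) polyring)"
      using module_hom_mat_fun by metis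
    then show "Modules.module_hom scale_fun scale_fun (d k)" for k
      using module_hom_mat_fun[of "D k"] by (simp add: d_def)
    show "d (Suc k) ` F (Suc k) \<subseteq> F k" for k
      using mat_fun_in[of "D (Suc k)"] dims[of k] zero_in by (auto simp: d_def F_def a'_def)
    show "{v \<in> F (Suc k). d (Suc k) v = 0} = d (Suc (Suc k)) ` F (Suc (Suc k))"
      if k: "Suc k \<le> n" for k
    proof (cases "Suc k = n")
      case True
      have "v = 0" if "v \<in> F (Suc k)" "d (Suc k) v = 0" for v
      proof -
        have v: "v \<in> free_module (length (a n))" using that True by (simp add: F_def a'_def)
        have "Matrix.vec (length (a n)) v \<in> mat_kernel (D n)"
          using mat_kernel_fun[of v "D n"] that(2) v dims(2)[OF k] True by (simp add: d_def)
        then have "Matrix.vec (length (a n)) v = Matrix.vec (length (a n)) 0"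
          unfolding ker_n by (auto simp: Matrix.vec_eq_iff)
        then show ?thesis using vec_fun_eq_iff[OF v zero_in] by blast
      qed
      moreover have "d (Suc k) 0 = 0"
        by (simp add: d_def mat_fun_def fun_eq_iff)
      ultimately show ?thesis
        using True zero_in by (auto simp: F_def a'_def d_def)
    next
      case False
      then have k2: "Suc (Suc k) \<le> n" using k by simp
      have "v \<in> mat_fun (D (Suc (Suc k))) ` free_module (length (a (Suc (Suc k)))) \<longleftrightarrow> mat_fun (D (Suc k)) v = 0"
        if "v \<in> free_module (length (a (Suc k)))" for v
        using mat_kernel_fun[of v "D (Suc k)"] mat_image_fun[of v "D (Suc (Suc k))"] that
          ker[of k] dims[OF k] dims[OF k2] k2 by simp
      moreover have "mat_fun (D (Suc (Suc k))) ` free_module (length (a (Suc (Suc k))))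
          \<subseteq> free_module (length (a (Suc k)))"
        using mat_fun_in[of "D (Suc (Suc k))"] dims[OF k2] by auto
      ultimately show ?thesis using k k2 by (auto simp: d_def F_def a'_def)
    qed
    show "v \<in> lines.ideal_mult j (F k)"
      if "j < n" "v \<in> F k" "scale_fun (lines.L j) v \<in> lines.ideal_mult j (F k)" for j v k
      using that unfolding F_def by (rule lines.regular_free_module)
    show "\<pi> k \<epsilon> (u + v) = \<pi> k \<epsilon> u + \<pi> k \<epsilon> v" for k \<epsilon> u v
      by (simp add: \<pi>_def fun_eq_iff homogeneous_part_add)
    show "\<pi> k \<epsilon> (\<pi> k \<epsilon> v) = \<pi> k \<epsilon> v" for k \<epsilon> v
      by (simp add: \<pi>_def fun_eq_iff homogeneous_part_homogeneous[OF homogeneous_homogeneous_part])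
    show "\<pi> k \<epsilon> v \<in> F k" for k \<epsilon> v
      by (simp add: \<pi>_def F_def free_module_def)
    show "\<pi> k \<epsilon> (d (Suc k) v) = d (Suc k) (\<pi> (Suc k) \<epsilon> v)" for k \<epsilon> v
    proof (cases "Suc k \<le> n")
      case True
      have "homogeneous_part (\<epsilon> - a k ! i) (D (Suc k) $$ (i, j) * v j) =
          D (Suc k) $$ (i, j) * homogeneous_part (\<epsilon> - a (Suc k) ! j) (v j)"
        if "i < length (a k)" "j < length (a (Suc k))" for i j
      proof -
        \<comment> \<open>The degree of the matrix entry is exactly the difference of the two
          shifts.\<close>
        have "homogeneous (a (Suc k) ! j - a k ! i) (D (Suc k) $$ (i, j))"
          using gr[OF True] that unfolding graded_map_def by blast
        from homogeneous_part_mult[OF this, of "\<epsilon> - a (Suc k) ! j"] show ?thesis by simp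
      qed
      then show ?thesis
        using True dims[OF True]
        by (auto simp: \<pi>_def d_def a'_def mat_fun_def fun_eq_iff homogeneous_part_sum intro!: sum.cong)
    qed (simp add: \<pi>_def d_def fun_eq_iff)
    show "\<pi> k (\<epsilon> + 1) (scale_fun (lines.L j) v) = scale_fun (lines.L j) (\<pi> k \<epsilon> v)" for j k \<epsilon> v
      using homogeneous_part_mult[OF lines.homogeneous_L[of j], of "\<epsilon> - a' k ! i" "v i" for i]
      by (simp add: \<pi>_def scale_fun_def fun_eq_iff algebra_simps)
  qed
  \<comment> \<open>Identifies the polynomial ring with \<open>F 0\<close>, which has rank one and
    shift 0; \<open>Z 0\<close> then corresponds to \<open>I\<close>.\<close>
  define emb :: "('v, 'k) polyring \<Rightarrow> nat \<Rightarrow> ('v, 'k) polyring"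
    where "emb p = (\<lambda>i. if i = 0 then p else 0)" for p
  have emb_F: "emb p \<in> F 0" for p
    by (simp add: emb_def F_def a'_def free_module_def a0)
  have emb_Z: "emb p \<in> Z 0 \<longleftrightarrow> p \<in> I" for p
  proof -
    have "emb p \<in> Z 0 \<longleftrightarrow> Matrix.vec 1 (emb p) \<in> mat_image (D 1)"
      using mat_image_fun[of "emb p" "D 1"] emb_F[of p] n dims[of 0]
      by (simp add: Z_def F_def d_def a'_def a0)
    then show ?thesis unfolding im by (simp add: emb_def)
  qed
  have "\<pi> 0 \<delta> (emb f) = emb f"
    using homogeneous_part_homogeneous[OF f(1), of \<delta>]
    by (auto simp: \<pi>_def emb_def a'_def a0 fun_eq_iff)
  moreover have "scale_fun (lines.L j) (emb f) \<in> Z 0" if "j < n" for j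
  proof -
    have "scale_fun (lines.L j) (emb f) = emb (lines.L j * f)"
      by (simp add: scale_fun_def emb_def fun_eq_iff)
    then show ?thesis using emb_Z f(3)[OF that] by simp
  qed
  ultimately obtain g where g: "\<pi> n (\<delta> + int n) g = g" "g \<noteq> 0"
    using ex_nonzero_in_top_module[OF emb_F, of \<delta> f] emb_Z f(2) by blast
  obtain i where "g i \<noteq> 0" using g(2) by (auto simp: fun_eq_iff)
  then have "\<pi> n (\<delta> + int n) g i \<noteq> 0" unfolding g(1) .
  then have i: "i < length (a n)" "homogeneous_part (\<delta> + int n - a n ! i) (g i) \<noteq> 0"
    by (auto simp: \<pi>_def a'_def split: if_splits)
  \<comment> \<open>A nonzero component cannot have negative degree.\<close>
  then have "a n ! i - int n \<le> \<delta>"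
    using homogeneous_part_negative[of "\<delta> + int n - a n ! i" "g i"] by linarith
  moreover have "min_socle_degree n a \<le> a n ! i - int n"
    unfolding min_socle_degree_def using i(1) by (intro Min_le) auto
  ultimately show ?thesis by simp
qed

theorem theorem2p4:
  fixes n :: nat
    and \<Gamma> :: "('k::field_char_0 ^ 'v::finite) set set"
    and a :: "nat \<Rightarrow> int list"
    and D :: "nat \<Rightarrow> ('v, 'k) polyring mat"
  assumes "n \<ge> 2"
    and "CARD('v) = n + 1"
    and "\<Gamma> \<subseteq> proj_points"
    and "finite \<Gamma>"
    and "\<not> (\<exists>H\<in>proj_hyperplanes. \<forall>P\<in>\<Gamma>. P \<subseteq> H)"
    and "minimal_graded_free_resolution n (vanishing_ideal \<Gamma>) a D"
  shows "int (min_distance \<Gamma>) \<ge> min_socle_degree n a"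
proof -
  obtain P p f where P: "P \<in> \<Gamma>" "p \<in> P" and f: "homogeneous (int (min_distance \<Gamma>)) f"
      "eval_at p f \<noteq> 0" "\<And>Q x. Q \<in> \<Gamma> - {P} \<Longrightarrow> x \<in> Q \<Longrightarrow> eval_at x f = 0"
    using ex_separator[OF assms(3-5)] by metis
  obtain q where q: "q \<noteq> 0" "P = vec.span {q}"
    using proj_point_generator[of P] P(1) assms(3) by blast
  obtain i0 where i0: "vec_nth q i0 \<noteq> 0" using q(1) by (auto simp: Finite_Cartesian_Product.vec_eq_iff)
  \<comment> \<open>The \<open>n\<close> coordinates other than \<open>i0\<close> give as many
    equations as the resolution has steps.\<close>
  have "card (UNIV - {i0}) = n" using assms(2) by (simp add: card_Diff_singleton)
  then obtain ix where ix: "bij_betw ix {..<n} (UNIV - {i0})"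
    using ex_bij_betw_nat_finite[of "UNIV - {i0}"] by (auto simp: lessThan_atLeast0)
  \<comment> \<open>Chosen so that each \<open>lines.L j\<close> with j < n vanishes at
    \<open>q\<close>, hence on all of \<open>P\<close>.\<close>
  define c where "c j = vec_nth q (ix j) / vec_nth q i0" for j
  have lines: "line_equations n ix i0"
    using ix unfolding bij_betw_def line_equations_def by blast
  interpret lines: line_equations n ix i0 c by (rule lines)
  show ?thesis
  proof (rule min_socle_degree_le[OF _ _ lines f(1)])
    show "graded_free_resolution n (vanishing_ideal \<Gamma>) a D" "1 \<le> n"
      using assms(1,6) by (auto simp: minimal_graded_free_resolution_def)
    show "f \<notin> vanishing_ideal \<Gamma>" using P f(2) by (auto simp: vanishing_ideal_def)
    show "lines.L j * f \<in> vanishing_ideal \<Gamma>" for j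
      unfolding vanishing_ideal_def
    proof (intro CollectI ballI)
      fix Q x assume Q: "Q \<in> \<Gamma>" "x \<in> Q"
      interpret comm_ring_hom "eval_at x" by (rule comm_ring_hom_eval_at)
      \<comment> \<open>The linear factor takes care of \<open>P\<close>, the separator
        \<open>f\<close> of all other points.\<close>
      have "eval_at x (lines.L j) = 0" if "x \<in> P"
      proof -
        obtain t where "x = t *s q" using \<open>x \<in> P\<close> unfolding q(2) vec.span_singleton by auto
        moreover have "eval_at x (lines.L j) = vec_nth x (ix j) - c j * vec_nth x i0"
          by (simp add: lines.L_def hom_minus hom_mult)
        ultimately show ?thesis using i0 by (simp add: c_def)
      qed
      then show "eval_at x (lines.L j * f) = 0"
        using f(3)[OF _ Q(2)] Q by (auto simp: hom_mult)
    qed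
  qed
qed

end
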